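(* Let $X=\{0,1\}^{\mathbb{Z}}$, let $T\colon X\to X$ be the left shift, let $$A_0=\begin{pmatrix}0&-1\\1&0\end{pmatrix},\qquad A_1=\begin{pmatrix}0.8&-0.1\\0.8&0.1\end{pmatrix},$$ and let $\Phi$ be the automorphism of the trivial vector bundle $\mathbb{E}=X\times\mathbb{R}^2$ given by $\Phi(x,u)=(Tx,A_{x_0}u)$. Then $\Phi$ admits no Riemannian extremal norm.
   Context: $X$ has the product topology, given by the metric $\mathrm{dist}(x,y)=e^{-\lambda k}$, $k=\min\{|n|:x_n\ne y_n\}$, with $\lambda>0$ a (large) parameter. $\Phi_x\colon\mathbb{E}_x\to\mathbb{E}_{Tx}$ and $\Phi^n_x\colon\mathbb{E}_x\to\mathbb{E}_{T^nx}$ denote the restrictions of $\Phi$, $\Phi^n$ to the fiber over $x$. A Finsler norm on $\mathbb{E}$ is a continuous function $\|\cdot\|\colon\mathbb{E}\to\mathbb{R}$ whose restriction to each fiber $\mathbb{E}_x$ is a norm $\|\cdot\|_x$; it is Riemannian if each $\|\cdot\|_x$ is induced by an inner product. For linear $L\colon\mathbb{E}_x\to\mathbb{E}_y$, $\|L\|=\sup_{u\ne0}\|Lu\|_y/\|u\|_x$. The maximal Lyapunov exponent is $\beta(\Phi)=\sup_\mu\int\lim_{n\to\infty}\frac1n\log\|\Phi^n_x\|\,d\mu(x)$, the supremum over all $T$-invariant Borel probability measures (independent of the Finsler norm). A Finsler norm is extremal for $\Phi$ if $\beta(\Phi)=\log\sup_{x\in X}\|\Phi_x\|$. *)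

theory Defs
  imports "HOL-Probability.Probability"
begin

text \<open>A trivial bundle with base \<open>'x\<close> and fibre \<open>'v\<close> is the product type \<open>'x \<times> 'v\<close>; the fibre over
  \<open>x\<close> consists of the pairs \<open>(x, u)\<close>. A norm on the bundle is a function \<open>N\<close> on pairs, \<open>N (x, u)\<close>
  being the norm of \<open>u\<close> in the fibre over \<open>x\<close>.\<close>

definition is_norm :: "('v::real_vector \<Rightarrow> real) \<Rightarrow> bool" where
  "is_norm f \<longleftrightarrow>
     (\<forall>u. 0 \<le> f u) \<and>
     (\<forall>u. f u = 0 \<longleftrightarrow> u = 0) \<and>
     (\<forall>c u. f (c *\<^sub>R u) = \<bar>c\<bar> * f u) \<and>
     (\<forall>u v. f (u + v) \<le> f u + f v)"

definition is_inner_product :: "('v::real_vector \<Rightarrow> 'v \<Rightarrow> real) \<Rightarrow> bool" where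
  "is_inner_product B \<longleftrightarrow>
     bilinear B \<and> (\<forall>u v. B u v = B v u) \<and> (\<forall>u. u \<noteq> 0 \<longrightarrow> 0 < B u u)"

definition finsler_norm :: "('x::topological_space \<times> 'v::real_normed_vector \<Rightarrow> real) \<Rightarrow> bool" where
  "finsler_norm N \<longleftrightarrow> continuous_on UNIV N \<and> (\<forall>x. is_norm (\<lambda>u. N (x, u)))"

definition riemannian_norm :: "('x::topological_space \<times> 'v::real_normed_vector \<Rightarrow> real) \<Rightarrow> bool" where
  "riemannian_norm N \<longleftrightarrow>
     finsler_norm N \<and> (\<forall>x. \<exists>B. is_inner_product B \<and> (\<forall>u. N (x, u) = sqrt (B u u)))"

definition fiber_map :: "('x \<times> 'v \<Rightarrow> 'x \<times> 'v) \<Rightarrow> 'x \<Rightarrow> 'v \<Rightarrow> 'v" where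
  "fiber_map F x u = snd (F (x, u))"

definition fiber_onorm :: "('x \<times> 'v::real_vector \<Rightarrow> real) \<Rightarrow> 'x \<Rightarrow> 'x \<Rightarrow> ('v \<Rightarrow> 'v) \<Rightarrow> real" where
  "fiber_onorm N x y L = (SUP u\<in>{u. u \<noteq> 0}. N (y, L u) / N (x, u))"

definition invariant_measures :: "('x::topological_space \<Rightarrow> 'x) \<Rightarrow> 'x measure set" where
  "invariant_measures T =
     {\<mu>. prob_space \<mu> \<and> sets \<mu> = sets borel \<and> T \<in> measurable \<mu> \<mu> \<and> distr \<mu> \<mu> T = \<mu>}"

definition growth_rate ::
    "('x \<Rightarrow> 'x) \<Rightarrow> ('x \<times> 'v::real_vector \<Rightarrow> 'x \<times> 'v) \<Rightarrow> ('x \<times> 'v \<Rightarrow> real) \<Rightarrow> 'x \<Rightarrow> nat \<Rightarrow> real" where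
  "growth_rate T F N x n =
     1 / real n * ln (fiber_onorm N x ((T ^^ n) x) (fiber_map (F ^^ n) x))"

text \<open>For a bundle automorphism over a homeomorphism of a compact base, the limit of the growth
  rates exists almost everywhere with respect to every invariant measure, by Kingman's subadditive
  ergodic theorem. The integral is therefore taken over the (full-measure) set of points where the
  limit exists. The resulting number does not depend on the Finsler norm \<open>N\<close>.\<close>

definition max_lyapunov_exponent ::
    "('x::topological_space \<Rightarrow> 'x) \<Rightarrow> ('x \<times> 'v::real_normed_vector \<Rightarrow> 'x \<times> 'v) \<Rightarrow>
     ('x \<times> 'v \<Rightarrow> real) \<Rightarrow> real" where
  "max_lyapunov_exponent T F N =
     (SUP \<mu>\<in>invariant_measures T.
        set_lebesgue_integral \<mu> {x. convergent (growth_rate T F N x)}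
          (\<lambda>x. lim (growth_rate T F N x)))"

definition extremal_norm ::
    "('x::topological_space \<Rightarrow> 'x) \<Rightarrow> ('x \<times> 'v::real_normed_vector \<Rightarrow> 'x \<times> 'v) \<Rightarrow>
     ('x \<times> 'v \<Rightarrow> real) \<Rightarrow> bool" where
  "extremal_norm T F N \<longleftrightarrow>
     finsler_norm N \<and>
     max_lyapunov_exponent T F N = ln (SUP x. fiber_onorm N x (T x) (fiber_map F x))"

text \<open>The space of bi-infinite binary sequences is the type \<^typ>\<open>int \<Rightarrow> bool\<close>, with \<open>False\<close> for the
  symbol 0 and \<open>True\<close> for the symbol 1. Its type-class topology is the product of the discrete
  topologies.\<close>

definition left_shift :: "(int \<Rightarrow> bool) \<Rightarrow> (int \<Rightarrow> bool)" where
  "left_shift x = (\<lambda>n. x (n + 1))"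

definition A0 :: "real^2^2" where
  "A0 = vector [vector [0, -1], vector [1, 0]]"

definition A1 :: "real^2^2" where
  "A1 = vector [vector [0.8, -0.1], vector [0.8, 0.1]]"

definition \<Phi> :: "(int \<Rightarrow> bool) \<times> (real^2) \<Rightarrow> (int \<Rightarrow> bool) \<times> (real^2)" where
  "\<Phi> = (\<lambda>(x, u). (left_shift x, (if x 0 then A1 else A0) *v u))"

end

theory Submission
  imports Defs
begin

text \<open>Products of \<open>A0\<close> and \<open>A1\<close> are bounded, so the maximal Lyapunov exponent is at most \<open>0\<close> and \<open>\<Phi>\<close>
  does not increase an extremal norm \<open>N\<close>. If \<open>N\<close> is Riemannian, its inner product over the fixed
  point \<open>0\<close> is invariant under the quarter turn \<open>A0\<close>, hence Euclidean up to a factor. Following the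
  orbit homoclinic to \<open>0\<close> with a single symbol 1, one sees that \<open>A1\<close> does not increase this Euclidean
  norm either; but \<open>A1\<close> maps \<open>(1, 0)\<close> to \<open>(0.8, 0.8)\<close>, which is longer.\<close>

section \<open>Euclidean estimates for words in \<open>A0\<close> and \<open>A1\<close>\<close>

lemma norm_vec2_sq: "(norm (u::real^2))\<^sup>2 = (u$1)\<^sup>2 + (u$2)\<^sup>2"
  by (simp add: norm_vec_def L2_set_def sum_2)

lemma norm_vec2_le:
  fixes u v :: "real^2"
  assumes "(u$1)\<^sup>2 + (u$2)\<^sup>2 \<le> (v$1)\<^sup>2 + (v$2)\<^sup>2"
  shows "norm u \<le> norm v"
  by (rule power2_le_imp_le) (simp_all add: norm_vec2_sq assms)

lemma A0_vec: "A0 *v u = vector [- u$2, u$1]"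
  by (simp add: A0_def vec_eq_iff forall_2 matrix_vector_mult_def sum_2)

lemma A1_vec: "A1 *v u = vector [0.8 * u$1 - 0.1 * u$2, 0.8 * u$1 + 0.1 * u$2]"
  by (simp add: A1_def vec_eq_iff forall_2 matrix_vector_mult_def sum_2)

lemma norm_A0: "norm (A0 *v u) = norm u"
  by (intro antisym norm_vec2_le) (simp_all add: A0_vec)

text \<open>\<open>A1\<close> stretches \<open>(1, 0)\<close> but turns it into a direction that a
  second \<open>A1\<close> shrinks. Completing the square shows that the loss of squared length is a
  nonnegative quadratic form.\<close>

lemma norm_A1_A1: "norm (A1 *v (A1 *v u)) \<le> norm u"
proof (rule norm_vec2_le)
  define a b where ab: "a = u$1" "b = u$2"
  have "a\<^sup>2 + b\<^sup>2 - ((0.56 * a - 0.09 * b)\<^sup>2 + (0.72 * a - 0.07 * b)\<^sup>2)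
      = (0.168 * a\<^sup>2 + 0.987 * b\<^sup>2 + 0.2016 * a * b)"
    by (simp add: power2_eq_square algebra_simps)
  also have "\<dots> = 0.168 * (a + 0.6 * b)\<^sup>2 + 0.92652 * b\<^sup>2"
    by (simp add: power2_eq_square algebra_simps)
  also have "\<dots> \<ge> 0" by simp
  finally have "(0.56 * a - 0.09 * b)\<^sup>2 + (0.72 * a - 0.07 * b)\<^sup>2 \<le> a\<^sup>2 + b\<^sup>2" by simp
  then show "((A1 *v (A1 *v u)) $ 1)\<^sup>2 + ((A1 *v (A1 *v u)) $ 2)\<^sup>2 \<le> (u$1)\<^sup>2 + (u$2)\<^sup>2"
    by (simp add: A1_vec ab[symmetric] power2_eq_square algebra_simps)
qed

text \<open>Up to sign, the letters between two consecutive \<open>A1\<close> reduce to nothing or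
  to one \<open>A0\<close>, so this is the only case besides \<open>norm_A1_A1\<close>. The
  quadratic form is the same with \<open>b\<close> replaced by \<open>-b\<close>.\<close>

lemma norm_A1_A0_A1: "norm (A1 *v (A0 *v (A1 *v u))) \<le> norm u"
proof (rule norm_vec2_le)
  define a b where ab: "a = u$1" "b = u$2"
  have "a\<^sup>2 + b\<^sup>2 - ((0.72 * a + 0.07 * b)\<^sup>2 + (0.56 * a + 0.09 * b)\<^sup>2)
      = (0.168 * a\<^sup>2 + 0.987 * b\<^sup>2 - 0.2016 * a * b)"
    by (simp add: power2_eq_square algebra_simps)
  also have "\<dots> = 0.168 * (a - 0.6 * b)\<^sup>2 + 0.92652 * b\<^sup>2"
    by (simp add: power2_eq_square algebra_simps)
  also have "\<dots> \<ge> 0" by simp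
  finally have "(0.72 * a + 0.07 * b)\<^sup>2 + (0.56 * a + 0.09 * b)\<^sup>2 \<le> a\<^sup>2 + b\<^sup>2" by simp
  then show "((A1 *v (A0 *v (A1 *v u))) $ 1)\<^sup>2 + ((A1 *v (A0 *v (A1 *v u))) $ 2)\<^sup>2 \<le> (u$1)\<^sup>2 + (u$2)\<^sup>2"
    by (simp add: A1_vec A0_vec ab[symmetric] power2_eq_square algebra_simps)
qed

text \<open>The word \<open>A0 A0 = - 1\<close> acts trivially and a word with two letters \<open>A1\<close> contracts the Euclidean
  norm, so this maximum is not increased by \<open>A0\<close> or \<open>A1\<close>.\<close>
definition adapted_norm :: "real^2 \<Rightarrow> real" where
  "adapted_norm u = max (norm u) (max (norm (A1 *v u)) (norm (A1 *v (A0 *v u))))"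

text \<open>Up to sign, \<open>A0\<close> swaps the last two terms of the maximum.\<close>

lemma adapted_norm_A0: "adapted_norm (A0 *v u) = adapted_norm u"
proof -
  have "A1 *v (A0 *v (A0 *v u)) = - (A1 *v u)"
    by (simp add: A0_vec A1_vec vec_eq_iff forall_2)
  then show ?thesis
    by (simp add: adapted_norm_def norm_A0 max.commute)
qed

text \<open>The first term, \<open>norm (A1 *v u)\<close>, already occurs in the maximum for
  \<open>u\<close>; the other two contain two letters \<open>A1\<close> and are at most
  \<open>norm u\<close>.\<close>

lemma adapted_norm_A1: "adapted_norm (A1 *v u) \<le> adapted_norm u"
  using norm_A1_A1[of u] norm_A1_A0_A1[of u] by (auto simp: adapted_norm_def)

lemma norm_A1: "norm (A1 *v u) \<le> 2 * norm u"
proof -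
  define a b where ab: "a = u$1" "b = u$2"
  have "norm (A1 *v u) \<le> norm (2 *\<^sub>R u)"
  proof (rule norm_vec2_le)
    have "4 * a\<^sup>2 + 4 * b\<^sup>2 - ((0.8 * a - 0.1 * b)\<^sup>2 + (0.8 * a + 0.1 * b)\<^sup>2)
        = 2.72 * a\<^sup>2 + 3.98 * b\<^sup>2"
      by (simp add: power2_eq_square algebra_simps)
    also have "\<dots> \<ge> 0" by simp
    finally show "((A1 *v u) $ 1)\<^sup>2 + ((A1 *v u) $ 2)\<^sup>2 \<le> ((2 *\<^sub>R u) $ 1)\<^sup>2 + ((2 *\<^sub>R u) $ 2)\<^sup>2"
      by (simp add: A1_vec ab[symmetric] power_mult_distrib)
  qed
  then show ?thesis by simp
qed

lemma norm_le_adapted_norm: "norm u \<le> adapted_norm u"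
  by (simp add: adapted_norm_def)

lemma adapted_norm_le: "adapted_norm u \<le> 2 * norm u"
  using norm_A1[of u] norm_A1[of "A0 *v u"] by (simp add: adapted_norm_def norm_A0)

lemma Phi_eq: "\<Phi> (x, u) = (left_shift x, (if x 0 then A1 else A0) *v u)"
  by (simp add: \<Phi>_def)

lemma adapted_norm_funpow_Phi: "adapted_norm (snd ((\<Phi> ^^ n) p)) \<le> adapted_norm (snd p)"
proof (induction n)
  case (Suc n)
  have "adapted_norm (snd (\<Phi> q)) \<le> adapted_norm (snd q)" for q
    by (cases q) (simp add: Phi_eq adapted_norm_A0 adapted_norm_A1)
  from this[of "(\<Phi> ^^ n) p"] Suc show ?case by simp
qed simp

text \<open>The adapted norm does not grow along orbits and lies between the Euclidean norm and its
  double, which bounds all iterates uniformly in \<open>n\<close> and \<open>x\<close>.\<close>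

lemma norm_funpow_Phi: "norm (fiber_map (\<Phi> ^^ n) x u) \<le> 2 * norm u"
  using norm_le_adapted_norm[of "snd ((\<Phi> ^^ n) (x, u))"] adapted_norm_funpow_Phi[of n "(x, u)"]
    adapted_norm_le[of u]
  by (simp add: fiber_map_def)

section \<open>Comparison of Finsler norms and fibre operator norms\<close>

lemma compact_UNIV_fun_bool: "compact (UNIV :: ('a \<Rightarrow> bool) set)"
proof -
  have "compact_space (euclidean :: bool topology)"
    by (simp add: compact_space_def finite_imp_compact)
  then have "compact_space (product_topology (\<lambda>_::'a. euclidean :: bool topology) UNIV)"
    by (simp add: compact_space_product_topology)
  then show ?thesis
    by (simp add: euclidean_product_topology compact_space_def)
qed

lemma finsler_normD:
  assumes "finsler_norm N"
  shows finsler_norm_continuous: "continuous_on UNIV N"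
    and finsler_norm_nonneg: "0 \<le> N (x, u)"
    and finsler_norm_eq_0: "N (x, u) = 0 \<longleftrightarrow> u = 0"
    and finsler_norm_scale: "N (x, c *\<^sub>R u) = \<bar>c\<bar> * N (x, u)"
  using assms by (auto simp: finsler_norm_def is_norm_def)

text \<open>\<open>m\<close> and \<open>M\<close> are the extreme values of \<open>N\<close> on the
  compact unit sphere bundle; homogeneity extends the bounds to all vectors.\<close>

lemma finsler_norm_comparable:
  fixes N :: "'x::topological_space \<times> 'v::euclidean_space \<Rightarrow> real"
  assumes N: "finsler_norm N" and X: "compact (UNIV :: 'x set)"
  obtains m M where "0 < m" "0 < M"
    "\<And>x u. m * norm u \<le> N (x, u)" "\<And>x u. N (x, u) \<le> M * norm u"
proof -
  let ?K = "(UNIV :: 'x set) \<times> sphere (0::'v) 1"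
  have K: "compact ?K" using X by (intro compact_Times) auto
  obtain e :: 'v where "norm e = 1"
    using norm_Basis SOME_Basis by blast
  then have ne: "?K \<noteq> {}" by auto
  have cont: "continuous_on ?K N"
    using finsler_norm_continuous[OF N] continuous_on_subset by blast
  obtain p where p: "p \<in> ?K" "\<And>q. q \<in> ?K \<Longrightarrow> N p \<le> N q"
    using continuous_attains_inf[OF K ne cont] by blast
  obtain P where P: "P \<in> ?K" "\<And>q. q \<in> ?K \<Longrightarrow> N q \<le> N P"
    using continuous_attains_sup[OF K ne cont] by blast
  have pos: "0 < N q" if "q \<in> ?K" for q
  proof -
    obtain x u where q: "q = (x, u)" by (cases q)
    with that have "u \<noteq> 0" by auto
    then show ?thesis
      using finsler_norm_nonneg[OF N, of x u] finsler_norm_eq_0[OF N, of x u] q by simp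
  qed
  have "N p * norm u \<le> N (x, u) \<and> N (x, u) \<le> N P * norm u" for x u
  proof (cases "u = 0")
    case True
    then show ?thesis using finsler_norm_eq_0[OF N, of x u] by simp
  next
    case False
    define v where "v = (1 / norm u) *\<^sub>R u"
    have v: "(x, v) \<in> ?K" and u: "u = norm u *\<^sub>R v" using False by (auto simp: v_def)
    have "N (x, u) = norm u * N (x, v)"
      by (subst u) (simp add: finsler_norm_scale[OF N])
    then show ?thesis
      using p(2)[OF v] P(2)[OF v] by (simp add: mult.commute[of _ "norm u"] mult_left_mono)
  qed
  then show ?thesis using that pos[OF p(1)] pos[OF P(1)] by blast
qed

text \<open>The constant \<open>C\<close> makes the set of quotients bounded above, so that its real
  supremum behaves as an operator norm.\<close>

lemma fiber_onorm_bounds: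
  fixes N :: "'x::topological_space \<times> 'v::euclidean_space \<Rightarrow> real"
  assumes N: "finsler_norm N" and C: "\<And>u. N (y, L u) \<le> C * N (x, u)"
  shows fiber_onorm_le: "fiber_onorm N x y L \<le> C"
    and fiber_onorm_nonneg: "0 \<le> fiber_onorm N x y L"
    and le_fiber_onorm: "u \<noteq> 0 \<Longrightarrow> N (y, L u) \<le> fiber_onorm N x y L * N (x, u)"
proof -
  have q: "N (y, L u) / N (x, u) \<le> C" if "u \<noteq> 0" for u
    using C[of u] finsler_norm_nonneg[OF N, of x u] finsler_norm_eq_0[OF N, of x u] that
    by (simp add: pos_divide_le_eq)
  have le: "N (y, L u) / N (x, u) \<le> fiber_onorm N x y L" if "u \<noteq> 0" for u
    unfolding fiber_onorm_def using that q by (intro cSUP_upper) (auto intro!: bdd_aboveI2)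
  obtain e :: 'v where e: "e \<noteq> 0"
    using nonzero_Basis SOME_Basis by blast
  then show "fiber_onorm N x y L \<le> C"
    unfolding fiber_onorm_def using q by (intro cSUP_least) auto
  have "0 \<le> N (y, L e) / N (x, e)"
    using finsler_norm_nonneg[OF N] by simp
  also note le[OF e]
  finally show "0 \<le> fiber_onorm N x y L" .
  show "N (y, L u) \<le> fiber_onorm N x y L * N (x, u)" if "u \<noteq> 0"
    using le[OF that] finsler_norm_nonneg[OF N, of x u] finsler_norm_eq_0[OF N, of x u] that
    by (simp add: pos_divide_le_eq)
qed

section \<open>Upper bound for the Lyapunov exponent\<close>

text \<open>A bound on the iterates that is uniform in \<open>n\<close> disappears after division by
  \<open>n\<close>.\<close>

lemma growth_rate_limit_nonpos:
  fixes N :: "'x::topological_space \<times> 'v::euclidean_space \<Rightarrow> real"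
  assumes N: "finsler_norm N" and C: "1 \<le> C"
    and bound: "\<And>n u. N ((T ^^ n) x, fiber_map (F ^^ n) x u) \<le> C * N (x, u)"
    and conv: "convergent (growth_rate T F N x)"
  shows "lim (growth_rate T F N x) \<le> 0"
proof (rule LIMSEQ_le)
  show "growth_rate T F N x \<longlonglongrightarrow> lim (growth_rate T F N x)"
    using conv by (simp add: convergent_LIMSEQ_iff)
  show "(\<lambda>n. ln C / real n) \<longlonglongrightarrow> 0"
    by (rule lim_const_over_n)
  have "growth_rate T F N x n \<le> ln C / real n" for n
  proof -
    let ?s = "fiber_onorm N x ((T ^^ n) x) (fiber_map (F ^^ n) x)"
    have s: "0 \<le> ?s" "?s \<le> C"
      using fiber_onorm_nonneg[OF N bound] fiber_onorm_le[OF N bound] by blast+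
    \<comment> \<open>If \<open>?s = 0\<close>, then \<open>ln ?s = 0\<close> by convention, and
      \<open>1 \<le> C\<close> gives the bound.\<close>
    have "ln ?s \<le> ln C"
      using s C by (cases "?s = 0") auto
    then show ?thesis
      by (simp add: growth_rate_def divide_right_mono)
  qed
  then show "\<exists>k. \<forall>n\<ge>k. growth_rate T F N x n \<le> ln C / real n" by blast
qed

lemma max_lyapunov_exponent_nonpos:
  assumes "invariant_measures T \<noteq> {}"
    and "\<And>x. convergent (growth_rate T F N x) \<Longrightarrow> lim (growth_rate T F N x) \<le> 0"
  shows "max_lyapunov_exponent T F N \<le> 0"
  unfolding max_lyapunov_exponent_def
proof (rule cSUP_least[OF assms(1)])
  fix \<mu> assume "\<mu> \<in> invariant_measures T"
  let ?g = "\<lambda>x. indicator {x. convergent (growth_rate T F N x)} x *\<^sub>R lim (growth_rate T F N x) :: real"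
  \<comment> \<open>This holds also without integrability, since the integral is then 0.\<close>
  have "0 \<le> (LINT x|\<mu>. - ?g x)"
    using assms(2) by (intro integral_nonneg_AE) (auto simp: indicator_def)
  then show "set_lebesgue_integral \<mu> {x. convergent (growth_rate T F N x)}
      (\<lambda>x. lim (growth_rate T F N x)) \<le> 0"
    by (simp add: set_lebesgue_integral_def)
qed

lemma continuous_left_shift: "continuous_on UNIV left_shift"
  unfolding left_shift_def
  by (intro continuous_on_coordinatewise_then_product continuous_on_product_coordinates)

text \<open>The Dirac measure at the fixed point is invariant. Nonemptiness gives meaning to the
  real supremum defining the exponent.\<close>

lemma invariant_measures_left_shift: "invariant_measures left_shift \<noteq> {}"
proof -
  let ?z = "\<lambda>_::int. False"
  have meas: "left_shift \<in> borel_measurable borel"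
    using continuous_left_shift by (rule borel_measurable_continuous_onI)
  have "return borel ?z \<in> invariant_measures left_shift"
    unfolding invariant_measures_def
  proof (intro CollectI conjI)
    show "prob_space (return borel ?z)" by (intro prob_space_return) simp
    show "sets (return borel ?z) = sets borel" by simp
    show "left_shift \<in> return borel ?z \<rightarrow>\<^sub>M return borel ?z"
      using meas by simp
    have "distr (return borel ?z) (return borel ?z) left_shift
        = distr (return borel ?z) borel left_shift"
      by (intro distr_cong) auto
    also have "\<dots> = return borel (left_shift ?z)"
      using meas by (intro distr_return) auto
    finally show "distr (return borel ?z) (return borel ?z) left_shift = return borel ?z"
      by (simp add: left_shift_def)
  qed
  then show ?thesis by blast
qed

lemma extremal_norm_Phi_contraction:
  assumes ext: "extremal_norm left_shift \<Phi> N"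
  shows "N (\<Phi> (x, u)) \<le> N (x, u)"
proof -
  have N: "finsler_norm N" using ext by (simp add: extremal_norm_def)
  obtain m M where mM: "0 < m" "0 < M"
    "\<And>x u. m * norm u \<le> N (x, u)" "\<And>x u. N (x, u) \<le> M * norm u"
    using finsler_norm_comparable[OF N compact_UNIV_fun_bool] by blast
  define C where "C = max 1 (2 * M / m)"
  \<comment> \<open>The target fibre \<open>y\<close> may be arbitrary because \<open>m\<close> and
    \<open>M\<close> do not depend on the base point.\<close>
  have bound: "N (y, fiber_map (\<Phi> ^^ n) x u) \<le> C * N (x, u)" for y x n u
  proof -
    have "N (y, fiber_map (\<Phi> ^^ n) x u) \<le> M * norm (fiber_map (\<Phi> ^^ n) x u)"
      by (rule mM)
    also have "\<dots> \<le> M * (2 * norm u)"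
      using norm_funpow_Phi mM(2) by (intro mult_left_mono) auto
    also have "\<dots> = (2 * M / m) * (m * norm u)"
      using mM(1) by simp
    also have "\<dots> \<le> C * N (x, u)"
      using mM by (intro mult_mono) (auto simp: C_def)
    finally show ?thesis .
  qed
  let ?s = "\<lambda>x. fiber_onorm N x (left_shift x) (fiber_map \<Phi> x)"
  have bound1: "N (y, fiber_map \<Phi> x u) \<le> C * N (x, u)" for y x u
    using bound[of y 1 x u] by simp
  have "max_lyapunov_exponent left_shift \<Phi> N \<le> 0"
    by (rule max_lyapunov_exponent_nonpos[OF invariant_measures_left_shift
          growth_rate_limit_nonpos[OF N _ bound]]) (simp_all add: C_def)
  then have "ln (SUP x. ?s x) \<le> 0"
    using ext by (simp add: extremal_norm_def)
  moreover have "?s x \<le> (SUP x. ?s x)"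
    using fiber_onorm_le[OF N bound1] by (intro cSUP_upper) (auto intro!: bdd_aboveI2)
  ultimately have "?s x \<le> 1"
    using ln_gt_zero[of "SUP x. ?s x"] by linarith
  then have "?s x * N (x, u) \<le> N (x, u)"
    using finsler_norm_nonneg[OF N, of x u] by (simp add: mult_left_le_one_le fiber_onorm_nonneg[OF N bound1])
  moreover have "N (\<Phi> (x, u)) \<le> ?s x * N (x, u)"
  proof (cases "u = 0")
    case True
    then have "N (\<Phi> (x, u)) = 0" "N (x, u) = 0"
      by (simp_all add: Phi_eq finsler_norm_eq_0[OF N])
    then show ?thesis by simp
  next
    case False
    have "\<Phi> (x, u) = (left_shift x, fiber_map \<Phi> x u)"
      by (simp add: fiber_map_def Phi_eq)
    with le_fiber_onorm[OF N bound1 False] show ?thesis by simp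
  qed
  ultimately show ?thesis by linarith
qed

section \<open>The homoclinic orbit and the contradiction\<close>

text \<open>The homoclinic orbit indexed by the position of its symbol 1: \<open>k > 0\<close>
  before this symbol is read, \<open>k = 0\<close> when it is read, \<open>k < 0\<close>
  afterwards.\<close>

definition pulse :: "int \<Rightarrow> int \<Rightarrow> bool" where
  "pulse k = (\<lambda>i. i = k)"

lemma left_shift_pulse: "left_shift (pulse k) = pulse (k - 1)"
  by (auto simp: left_shift_def pulse_def)

lemma pulse_tendsto:
  assumes "\<And>i. eventually (\<lambda>n. f n \<noteq> i) sequentially"
  shows "(\<lambda>n. pulse (f n)) \<longlonglongrightarrow> (\<lambda>_. False)"
proof -
  have "((\<lambda>n. pulse (f n) i) \<longlongrightarrow> False) sequentially" for i
    using assms[of i] by (intro tendsto_eventually) (auto simp: pulse_def elim: eventually_mono)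
  then have "limitin (product_topology (\<lambda>_. euclidean) UNIV) (\<lambda>n. pulse (f n)) (\<lambda>_. False) sequentially"
    by (simp add: limitin_componentwise)
  then show ?thesis
    by (simp add: euclidean_product_topology)
qed

lemma parallelogram_inner_product:
  assumes "is_inner_product B"
  shows "B (u + v) (u + v) + B (u - v) (u - v) = 2 * B u u + 2 * B v v"
  using assms
  by (simp add: is_inner_product_def bilinear_ladd bilinear_radd bilinear_lsub bilinear_rsub)

theorem propositionB5:
  "\<not> (\<exists>N :: (int \<Rightarrow> bool) \<times> (real^2) \<Rightarrow> real.
        riemannian_norm N \<and> extremal_norm left_shift \<Phi> N)"
proof
  assume "\<exists>N :: (int \<Rightarrow> bool) \<times> (real^2) \<Rightarrow> real.
        riemannian_norm N \<and> extremal_norm left_shift \<Phi> N"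
  then obtain N :: "(int \<Rightarrow> bool) \<times> (real^2) \<Rightarrow> real"
    where R: "riemannian_norm N" and E: "extremal_norm left_shift \<Phi> N" by blast
  have F: "finsler_norm N" using R by (simp add: riemannian_norm_def)
  note step = extremal_norm_Phi_contraction[OF E]
  let ?z = "\<lambda>_::int. False"
  define e where "e = (vector [1, 0] :: real^2)"

  have A0_4: "A0 *v (A0 *v (A0 *v (A0 *v u))) = u" for u
    by (simp add: A0_vec vec_eq_iff forall_2)
  have step0: "N (pulse (k - 1), A0 *v u) \<le> N (pulse k, u)" if "k \<noteq> 0" for k u
    using step[of "pulse k" u] that by (simp add: Phi_eq left_shift_pulse) (simp add: pulse_def)
  \<comment> \<open>Four quarter turns give the identity, so the same vector \<open>u\<close>
    appears on both sides. For \<open>k\<close> in \<open>{0..3}\<close> one of the four letters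
    would be \<open>A1\<close>.\<close>
  have step4: "N (pulse (k - 4), u) \<le> N (pulse k, u)" if "k \<notin> {0..3}" for k u
  proof -
    have "k \<noteq> 0" "k - 1 \<noteq> 0" "k - 2 \<noteq> 0" "k - 3 \<noteq> 0"
      using that by auto
    note s = this[THEN step0]
    show ?thesis
      using s(1)[of u] s(2)[of "A0 *v u"] s(3)[of "A0 *v (A0 *v u)"]
        s(4)[of "A0 *v (A0 *v (A0 *v u))"]
      by (simp add: A0_4)
  qed
  have before: "N (pulse 0, u) \<le> N (pulse (4 * int n), u)" for n u
  proof (induction n)
    case (Suc n)
    then show ?case using step4[of "4 * int (Suc n)" u] by simp
  qed simp
  \<comment> \<open>Reading the symbol 1 moves the pulse from 0 to -1, where the second tail of the
    orbit starts.\<close>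
  have after: "N (pulse (- 1 - 4 * int n), u) \<le> N (pulse (- 1), u)" for n u
  proof (induction n)
    case (Suc n)
    then show ?case using step4[of "- 1 - 4 * int n" u] by simp
  qed simp
  have middle: "N (pulse (- 1), A1 *v e) \<le> N (pulse 0, e)"
    using step[of "pulse 0" e] by (simp add: Phi_eq left_shift_pulse) (simp add: pulse_def)

  \<comment> \<open>Both tails converge to the fixed point, so continuity of \<open>N\<close>
    carries \<open>before\<close> and \<open>after\<close> over to its fibre.\<close>
  have lim: "(\<lambda>n. N (pulse (f n), u)) \<longlonglongrightarrow> N (?z, u)"
    if "\<And>i. eventually (\<lambda>n. f n \<noteq> i) sequentially" for f u
  proof (rule continuous_on_tendsto_compose[OF finsler_norm_continuous[OF F]])
    show "(\<lambda>n. (pulse (f n), u)) \<longlonglongrightarrow> (?z, u)"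
      by (intro tendsto_Pair tendsto_const pulse_tendsto that)
  qed auto
  have "eventually (\<lambda>n. 4 * int n \<noteq> i) sequentially" for i
    by (rule eventually_sequentiallyI[of "nat (\<bar>i\<bar> + 1)"]) linarith
  from lim[OF this] have "N (pulse 0, e) \<le> N (?z, e)"
    by (rule LIMSEQ_le_const) (use before in blast)
  moreover have "eventually (\<lambda>n. - 1 - 4 * int n \<noteq> i) sequentially" for i
    by (rule eventually_sequentiallyI[of "nat (\<bar>i\<bar> + 1)"]) linarith
  from lim[OF this] have "N (?z, A1 *v e) \<le> N (pulse (- 1), A1 *v e)"
    by (rule LIMSEQ_le_const2) (use after in blast)
  ultimately have A1_le: "N (?z, A1 *v e) \<le> N (?z, e)"
    using middle by linarith

  define e' where "e' = (vector [0, 1] :: real^2)"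
  obtain B where B: "is_inner_product B" and NB: "\<And>u. N (?z, u) = sqrt (B u u)"
    using R by (auto simp: riemannian_norm_def)
  have "N (?z, A0 *v u) \<le> N (?z, u)" for u
    using step[of ?z u] by (simp add: Phi_eq left_shift_def)
  then have le: "B (A0 *v u) (A0 *v u) \<le> B u u" for u
    by (simp add: NB)
  \<comment> \<open>The four inequalities along the \<open>A0\<close>-orbit of \<open>u\<close>
    close up to a cycle, hence all are equalities.\<close>
  then have A0_eq: "B (A0 *v u) (A0 *v u) = B u u" for u
    using le[of u] le[of "A0 *v u"] le[of "A0 *v (A0 *v u)"] le[of "A0 *v (A0 *v (A0 *v u))"]
    unfolding A0_4 by linarith
  \<comment> \<open>The quarter turn maps one diagonal of the square on \<open>e\<close> and
    \<open>e'\<close> to the other. The diagonals thus have equal length, which the parallelogram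
    law determines; this is where the norm must be Riemannian.\<close>
  have "A0 *v e = e'" "A0 *v (e - e') = e + e'"
    by (simp_all add: A0_vec e_def e'_def vec_eq_iff forall_2)
  then have "B e' e' = B e e" "B (e + e') (e + e') = B (e - e') (e - e')"
    using A0_eq[of e] A0_eq[of "e - e'"] by simp_all
  then have sum: "B (e + e') (e + e') = 2 * B e e"
    using parallelogram_inner_product[OF B, of e e'] by simp
  have "A1 *v e = 0.8 *\<^sub>R (e + e')"
    by (simp add: A1_vec e_def e'_def vec_eq_iff forall_2)
  then have "N (?z, A1 *v e) = 0.8 * sqrt (2 * B e e)"
    using finsler_norm_scale[OF F, of ?z "0.8" "e + e'"] NB[of "e + e'"] sum by simp
  with A1_le NB[of e] have "0.8 * sqrt (2 * B e e) \<le> sqrt (B e e)"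
    by linarith
  then have "0.8 * sqrt 2 * sqrt (B e e) \<le> 1 * sqrt (B e e)"
    by (simp add: real_sqrt_mult mult.assoc)
  moreover have "0 < B e e"
    using B by (simp add: is_inner_product_def e_def vec_eq_iff forall_2)
  ultimately have "0.8 * sqrt 2 \<le> (1::real)"
    by (metis mult_le_cancel_right_pos real_sqrt_gt_0_iff)
  \<comment> \<open>The bound \<open>5 / 4\<close> is the reciprocal of \<open>0.8\<close>.\<close>
  moreover have "5 / 4 < sqrt (2::real)"
    by (rule real_less_rsqrt) (simp add: power2_eq_square)
  ultimately show False
    by simp
qed

end
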